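(* Let $X$ be a Banach space, $\lambda_1,\lambda_2>0$ and $Y\subset X$ a closed subspace which is $\lambda_1$-complemented in its bidual $Y^{**}$. If there is a $\lambda_2$-Lipschitz retraction from $X$ onto a convex subset $K\subset X$ containing $0$ such that $\overline{\mathrm{span}}(K)=Y$, then $Y$ is $\lambda_1\lambda_2$-complemented in $X$.
   Context: All Banach spaces are real. A closed subspace $Y$ of a Banach space $Z$ is $\lambda$-complemented in $Z$ if there is a bounded linear projection from $Z$ onto $Y$ of norm at most $\lambda$; $Y$ is regarded as a subspace of $Y^{**}$ via the canonical embedding. A $\lambda$-Lipschitz retraction from $X$ onto $K\subset X$ is a $\lambda$-Lipschitz map $R:X\to K$ with $R|_K=\mathrm{Id}_K$. *)

theory Defs
  imports "HOL-Analysis.Analysis" "HOL-Library.Function_Algebras"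
begin

text \<open>
  The dual of a subspace is not a type, so normed spaces are represented by a linear subspace
  \<open>V\<close> of a real vector space together with a norm function \<open>n\<close> on it. Functionals on \<open>V\<close> are
  total functions vanishing outside \<open>V\<close>; pointwise operations make them a real vector space
  again, so that the construction of the dual can be iterated.
\<close>

instantiation "fun" :: (type, real_vector) real_vector
begin

definition scaleR_fun :: "real \<Rightarrow> ('a \<Rightarrow> 'b) \<Rightarrow> 'a \<Rightarrow> 'b" where
  "scaleR_fun c f = (\<lambda>x. c *\<^sub>R f x)"

instance
  by standard (auto simp: scaleR_fun_def plus_fun_def fun_eq_iff algebra_simps)

end

definition linear_map_on :: "'v::real_vector set \<Rightarrow> ('v \<Rightarrow> 'w::real_vector) \<Rightarrow> bool" where
  "linear_map_on V T \<longleftrightarrow>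
     (\<forall>x\<in>V. \<forall>y\<in>V. T (x + y) = T x + T y) \<and> (\<forall>c. \<forall>x\<in>V. T (c *\<^sub>R x) = c *\<^sub>R T x)"

definition bounded_operator ::
  "'v::real_vector set \<Rightarrow> ('v \<Rightarrow> real) \<Rightarrow> ('w::real_vector \<Rightarrow> real) \<Rightarrow> ('v \<Rightarrow> 'w) \<Rightarrow> bool" where
  "bounded_operator V n m T \<longleftrightarrow> linear_map_on V T \<and> (\<exists>C. \<forall>x\<in>V. m (T x) \<le> C * n x)"

definition operator_norm ::
  "'v::real_vector set \<Rightarrow> ('v \<Rightarrow> real) \<Rightarrow> ('w::real_vector \<Rightarrow> real) \<Rightarrow> ('v \<Rightarrow> 'w) \<Rightarrow> real" where
  "operator_norm V n m T = (SUP x\<in>{x\<in>V. n x \<le> 1}. m (T x))"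

definition dual :: "'v::real_vector set \<Rightarrow> ('v \<Rightarrow> real) \<Rightarrow> ('v \<Rightarrow> real) set" where
  "dual V n = {f. bounded_operator V n norm f \<and> (\<forall>x. x \<notin> V \<longrightarrow> f x = 0)}"

definition dual_norm :: "'v::real_vector set \<Rightarrow> ('v \<Rightarrow> real) \<Rightarrow> ('v \<Rightarrow> real) \<Rightarrow> real" where
  "dual_norm V n f = operator_norm V n norm f"

definition bidual :: "'v::real_vector set \<Rightarrow> ('v \<Rightarrow> real) \<Rightarrow> (('v \<Rightarrow> real) \<Rightarrow> real) set" where
  "bidual V n = dual (dual V n) (dual_norm V n)"

definition bidual_norm ::
  "'v::real_vector set \<Rightarrow> ('v \<Rightarrow> real) \<Rightarrow> (('v \<Rightarrow> real) \<Rightarrow> real) \<Rightarrow> real" where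
  "bidual_norm V n = dual_norm (dual V n) (dual_norm V n)"

definition canonical_embedding ::
  "'v::real_vector set \<Rightarrow> ('v \<Rightarrow> real) \<Rightarrow> 'v \<Rightarrow> ('v \<Rightarrow> real) \<Rightarrow> real" where
  "canonical_embedding V n x = (\<lambda>f. if f \<in> dual V n then f x else 0)"

definition complemented ::
  "real \<Rightarrow> 'v::real_vector set \<Rightarrow> 'v set \<Rightarrow> ('v \<Rightarrow> real) \<Rightarrow> bool" where
  "complemented L Y Z n \<longleftrightarrow>
     (\<exists>P. bounded_operator Z n n P \<and> operator_norm Z n n P \<le> L \<and>
          P ` Z = Y \<and> (\<forall>y\<in>Y. P y = y))"

definition complemented_in_bidual :: "real \<Rightarrow> 'a::real_normed_vector set \<Rightarrow> bool" where
  "complemented_in_bidual L Y \<longleftrightarrow>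
     complemented L (canonical_embedding Y norm ` Y) (bidual Y norm) (bidual_norm Y norm)"

definition lipschitz_retraction ::
  "real \<Rightarrow> 'a::metric_space set \<Rightarrow> ('a \<Rightarrow> 'a) \<Rightarrow> bool" where
  "lipschitz_retraction L K R \<longleftrightarrow>
     L-lipschitz_on UNIV R \<and> range R \<subseteq> K \<and> (\<forall>x\<in>K. R x = x)"

end

theory Submission
  imports Defs
begin

text \<open>
  Let \<open>R\<close> be the retraction and \<open>C\<close> the convex cone generated by \<open>K\<close>. The rescaled maps
  \<open>F n x = n *\<^sub>R R (x /\<^sub>R n)\<close> are again \<open>l\<^sub>2\<close>-Lipschitz, and each point of \<open>C\<close> is fixed by all but
  finitely many of them. Averaging over the translates by \<open>0, a, ..., (N - 1) a\<close> telescopes the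
  increment in direction \<open>a\<close> to \<open>(g (x + N a) - g x) / N\<close>. Averaging first in finitely many
  directions of \<open>X\<close> makes the maps almost additive in these directions and moves them only a
  bounded distance away from the identity on \<open>C\<close>; averaging afterwards in finitely many directions
  of \<open>K\<close> makes the corresponding increments almost equal to the identity, since the bounded error is
  divided by \<open>N\<close>. By Tychonoff's theorem the resulting maps have a weak-star cluster point
  \<open>W\<close> from \<open>X\<close> to the bidual of \<open>Y\<close>, which is linear of norm at most \<open>l\<^sub>2\<close> and extends the canonical
  embedding of \<open>Y\<close>. Composing with the projection of the bidual onto \<open>Y\<close> gives the result; that the
  canonical embedding is isometric is the Hahn-Banach theorem.
\<close>

section \<open>The Hahn-Banach theorem\<close>

definition sublinear :: "('a::real_vector \<Rightarrow> real) \<Rightarrow> bool" where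
  "sublinear q \<longleftrightarrow> (\<forall>x y. q (x + y) \<le> q x + q y) \<and> (\<forall>c\<ge>0. \<forall>x. q (c *\<^sub>R x) \<le> c * q x)"

lemma sublinear_add: "sublinear q \<Longrightarrow> q (x + y) \<le> q x + q y"
  and sublinear_scaleR_le: "sublinear q \<Longrightarrow> 0 \<le> c \<Longrightarrow> q (c *\<^sub>R x) \<le> c * q x"
  by (auto simp: sublinear_def)

lemma sublinear_zero: "sublinear q \<Longrightarrow> q 0 = 0"
  using sublinear_add[of q 0 0] sublinear_scaleR_le[of q 0 0] by simp

lemma sublinear_minus: "sublinear q \<Longrightarrow> - q (- x) \<le> q x"
  using sublinear_add[of q x "- x"] sublinear_zero[of q] by simp

lemma sublinear_scaleR:
  assumes "sublinear q" "0 \<le> c"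
  shows "q (c *\<^sub>R x) = c * q x"
proof (cases "c = 0")
  case True
  then show ?thesis using sublinear_zero[OF assms(1)] by simp
next
  case False
  with assms have "c > 0" by simp
  then have "q (inverse c *\<^sub>R (c *\<^sub>R x)) \<le> inverse c * q (c *\<^sub>R x)"
    by (intro sublinear_scaleR_le assms) simp
  then have "c * q x \<le> q (c *\<^sub>R x)" using \<open>c > 0\<close> by (simp add: field_simps)
  with sublinear_scaleR_le[OF assms, of x] show ?thesis by simp
qed

text \<open>Once \<open>q\<close> is odd, subadditivity at \<open>- x\<close> and \<open>- y\<close>
  becomes superadditivity at \<open>x\<close> and \<open>y\<close>.\<close>

lemma linear_if_sublinear_odd:
  assumes q: "sublinear q" and odd: "\<And>z. q (- z) \<le> - q z"
  shows "linear q"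
proof -
  have neg: "q (- z) = - q z" for z
    using odd[of z] sublinear_minus[OF q, of z] by simp
  show ?thesis
  proof
    fix x y :: 'a
    show "q (x + y) = q x + q y"
      using sublinear_add[OF q, of x y] sublinear_add[OF q, of "- x" "- y"] neg[of "x + y"]
      by (simp add: neg)
  next
    fix c :: real and x :: 'a
    show "q (c *\<^sub>R x) = c *\<^sub>R q x"
    proof (cases "c \<ge> 0")
      case True
      then show ?thesis by (simp add: sublinear_scaleR[OF q])
    next
      case False
      then have "q ((- c) *\<^sub>R x) = (- c) * q x" by (intro sublinear_scaleR[OF q]) simp
      then show ?thesis using neg[of "c *\<^sub>R x"] by simp
    qed
  qed
qed

text \<open>A sublinear functional below \<open>q\<close> that is at most \<open>- q z\<close> at
  \<open>- z\<close> must lie below \<open>q (x + t *\<^sub>R z) - t * q z\<close> for each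
  \<open>t \<ge> 0\<close>, so the infimum of these is the candidate. The choice
  \<open>t = 1\<close> at \<open>- z\<close> gives the last property.\<close>

lemma sublinear_decrease:
  assumes q: "sublinear q"
  obtains q' where "sublinear q'" "\<And>x. q' x \<le> q x" "q' (- z) \<le> - q z"
proof -
  define q' where "q' x = (INF t\<in>{0..}. q (x + t *\<^sub>R z) - t * q z)" for x
  \<comment> \<open>The bound is independent of \<open>t\<close>, so the infimum is finite.\<close>
  have lower: "- q (- x) \<le> q (x + t *\<^sub>R z) - t * q z" if "t \<ge> 0" for x t
    using sublinear_add[OF q, of "x + t *\<^sub>R z" "- x"] sublinear_scaleR[OF q that, of z] by simp
  have q'_le: "q' x \<le> q (x + t *\<^sub>R z) - t * q z" if "t \<ge> 0" for x t
    unfolding q'_def by (rule cINF_lower) (use lower that in \<open>auto intro!: bdd_belowI2\<close>)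
  have le_q': "m \<le> q' x" if "\<And>t. t \<ge> 0 \<Longrightarrow> m \<le> q (x + t *\<^sub>R z) - t * q z" for m x
    unfolding q'_def by (rule cINF_greatest) (use that in auto)
  have "q' (x + y) \<le> q' x + q' y" for x y
  proof -
    have "q' (x + y) - (q (y + s *\<^sub>R z) - s * q z) \<le> q' x" if s: "s \<ge> 0" for s
    proof (rule le_q')
      fix t :: real assume t: "t \<ge> 0"
      \<comment> \<open>The parameters of the two infima add up to an admissible parameter for
        \<open>x + y\<close>.\<close>
      have "q ((x + t *\<^sub>R z) + (y + s *\<^sub>R z)) \<le> q (x + t *\<^sub>R z) + q (y + s *\<^sub>R z)"
        by (rule sublinear_add[OF q])
      moreover have "(x + t *\<^sub>R z) + (y + s *\<^sub>R z) = (x + y) + (t + s) *\<^sub>R z"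
        by (simp add: algebra_simps)
      ultimately show "q' (x + y) - (q (y + s *\<^sub>R z) - s * q z) \<le> q (x + t *\<^sub>R z) - t * q z"
        using q'_le[of "t + s" "x + y"] s t by (simp add: algebra_simps)
    qed
    then have "q' (x + y) - q' x \<le> q' y"
      by (intro le_q') (simp add: algebra_simps)
    then show ?thesis by simp
  qed
  moreover have "q' (c *\<^sub>R x) \<le> c * q' x" if "c \<ge> 0" for c x
  proof (cases "c = 0")
    case True
    then show ?thesis using q'_le[of 0 0] sublinear_zero[OF q] by simp
  next
    case False
    with that have c: "c > 0" by simp
    have "q' (c *\<^sub>R x) / c \<le> q' x"
    proof (rule le_q')
      fix t :: real assume t: "t \<ge> 0"
      have "q' (c *\<^sub>R x) \<le> q (c *\<^sub>R (x + t *\<^sub>R z)) - (c * t) * q z"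
        using q'_le[of "c * t" "c *\<^sub>R x"] c t by (simp add: algebra_simps)
      also have "\<dots> = c * (q (x + t *\<^sub>R z) - t * q z)"
        by (simp only: sublinear_scaleR[OF q that] right_diff_distrib mult.assoc)
      finally show "q' (c *\<^sub>R x) / c \<le> q (x + t *\<^sub>R z) - t * q z"
        using c by (simp add: field_simps)
    qed
    then show ?thesis using c by (simp add: field_simps)
  qed
  ultimately have "sublinear q'" by (auto simp: sublinear_def)
  moreover have "q' x \<le> q x" for x using q'_le[of 0 x] by simp
  moreover have "q' (- z) \<le> - q z" using q'_le[of 1 "- z"] sublinear_zero[OF q] by simp
  ultimately show ?thesis using that by blast
qed

text \<open>
  Zorn's lemma gives a pointwise minimal sublinear functional below \<open>p\<close>; it admits no proper
  decrease, so it is odd and therefore linear.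
\<close>

theorem hahn_banach_sublinear:
  fixes p :: "'a::real_vector \<Rightarrow> real"
  assumes p: "sublinear p"
  obtains f where "linear f" "\<And>x. f x \<le> p x"
proof -
  define A where "A = {q. sublinear q \<and> (\<forall>x. q x \<le> p x)}"
  have "\<exists>m\<in>A. \<forall>q\<in>A. (\<forall>x. q x \<le> m x) \<longrightarrow> q = m"
  proof (rule predicate_Zorn)
    \<comment> \<open>The order is reversed, so that Zorn's lemma yields a pointwise minimal
      functional.\<close>
    show "partial_order_on A (relation_of (\<lambda>m q. \<forall>x. q x \<le> m x) A)"
      by (rule partial_order_on_relation_ofI) (auto intro: order_trans antisym simp: fun_eq_iff)
  next
    fix C assume C: "C \<in> Chains (relation_of (\<lambda>m q. \<forall>x. q x \<le> m x) A)"
    then have CA: "C \<subseteq> A"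
      and chain: "\<And>q r. q \<in> C \<Longrightarrow> r \<in> C \<Longrightarrow> (\<forall>x. q x \<le> r x) \<or> (\<forall>x. r x \<le> q x)"
      by (auto simp: Chains_def relation_of_def)
    show "\<exists>u\<in>A. \<forall>q\<in>C. \<forall>x. u x \<le> q x"
    proof (cases "C = {}")
      case True
      then show ?thesis using p by (auto simp: A_def)
    next
      case False
      define u where "u x = (INF q\<in>C. q x)" for x
      have lower: "- p (- x) \<le> q x" if "q \<in> C" for q x
      proof -
        have "sublinear q" "q (- x) \<le> p (- x)" using that CA by (auto simp: A_def)
        then show ?thesis using sublinear_minus[of q x] by linarith
      qed
      have u_le: "u x \<le> q x" if "q \<in> C" for q x
        unfolding u_def by (rule cINF_lower) (use lower that in \<open>auto intro!: bdd_belowI2\<close>)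
      have le_u: "m \<le> u x" if "\<And>q. q \<in> C \<Longrightarrow> m \<le> q x" for m x
        unfolding u_def by (rule cINF_greatest) (use that False in auto)
      have "u (x + y) \<le> u x + u y" for x y
      proof -
        have "u (x + y) - r y \<le> q x" if qr: "q \<in> C" "r \<in> C" for q r
        proof -
          \<comment> \<open>In a chain the smaller of \<open>q\<close> and \<open>r\<close> serves
            at both points at once.\<close>
          obtain s where s: "s \<in> C" "s x \<le> q x" "s y \<le> r y"
            using chain[OF qr] qr by auto
          then have "s (x + y) \<le> s x + s y" using CA by (auto simp: A_def sublinear_def)
          with s u_le[OF s(1), of "x + y"] show ?thesis by linarith
        qed
        then have "u (x + y) - r y \<le> u x" if "r \<in> C" for r using that by (intro le_u)
        then have "u (x + y) - u x \<le> u y" by (intro le_u) (simp add: algebra_simps)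
        then show ?thesis by simp
      qed
      moreover have "u (c *\<^sub>R x) \<le> c * u x" if c: "c \<ge> 0" for c x
      proof (cases "c = 0")
        case True
        obtain q where "q \<in> C" using False by blast
        moreover have "q 0 = 0" using \<open>q \<in> C\<close> CA by (auto simp: A_def sublinear_zero)
        ultimately show ?thesis using u_le[of q 0] True by simp
      next
        case False
        have "u (c *\<^sub>R x) / c \<le> u x"
        proof (rule le_u)
          fix q assume "q \<in> C"
          then have "u (c *\<^sub>R x) \<le> q (c *\<^sub>R x)" "sublinear q" using u_le CA by (auto simp: A_def)
          then show "u (c *\<^sub>R x) / c \<le> q x"
            using sublinear_scaleR_le[of q c x] c False by (simp add: field_simps)
        qed
        then show ?thesis using c False by (simp add: field_simps)
      qed
      ultimately have "sublinear u" by (auto simp: sublinear_def)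
      moreover have "u x \<le> p x" for x
      proof -
        obtain q where "q \<in> C" using False by blast
        then have "u x \<le> q x" "q x \<le> p x" using u_le CA by (auto simp: A_def)
        then show ?thesis by (rule order_trans)
      qed
      ultimately show ?thesis using u_le by (auto simp: A_def)
    qed
  qed
  then obtain m where "m \<in> A" and m_min: "\<And>q. q \<in> A \<Longrightarrow> (\<And>x. q x \<le> m x) \<Longrightarrow> q = m"
    by blast
  then have m: "sublinear m" "\<And>x. m x \<le> p x" by (auto simp: A_def)
  \<comment> \<open>Whatever lies below \<open>m\<close> also lies below \<open>p\<close>, so
    \<open>m\<close> is minimal among all sublinear functionals.\<close>
  have minimal: "q = m" if "sublinear q" "\<And>x. q x \<le> m x" for q
    using that order_trans[OF that(2) m(2)] by (intro m_min) (auto simp: A_def)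
  have "m (- z) \<le> - m z" for z
  proof -
    obtain q where q: "sublinear q" "\<And>x. q x \<le> m x" "q (- z) \<le> - m z"
      using sublinear_decrease[OF m(1), of z] by blast
    then show ?thesis using minimal[of q] by auto
  qed
  then have "linear m" using linear_if_sublinear_odd m(1) by blast
  with m(2) show ?thesis using that by blast
qed

text \<open>Lowering the norm in direction \<open>z\<close> first forces the value at
  \<open>z\<close>: every linear functional below the lowered one is at most \<open>- norm z\<close>
  at \<open>- z\<close>. This replaces an extension from the line through \<open>z\<close>.\<close>

lemma norming_functional:
  fixes z :: "'a::real_normed_vector"
  obtains f :: "'a \<Rightarrow> real" where "linear f" "\<And>x. \<bar>f x\<bar> \<le> norm x" "f z = norm z"
proof -
  have "sublinear (norm :: 'a \<Rightarrow> real)" by (auto simp: sublinear_def norm_triangle_ineq)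
  then obtain q where q: "sublinear q" "\<And>x. q x \<le> norm x" "q (- z) \<le> - norm z"
    using sublinear_decrease[of norm z] by blast
  then obtain f where f: "linear f" "\<And>x. f x \<le> q x"
    using hahn_banach_sublinear by blast
  have le: "f x \<le> norm x" for x using f(2)[of x] q(2)[of x] by linarith
  then have "\<bar>f x\<bar> \<le> norm x" for x
    using le[of x] le[of "- x"] linear_neg[OF f(1), of x] by (simp add: abs_le_iff)
  moreover have "f z = norm z"
    using f(2)[of "- z"] q(3) linear_neg[OF f(1), of z] le[of z] by simp
  ultimately show ?thesis using that f(1) by blast
qed

section \<open>Averages along arithmetic progressions\<close>

text \<open>Only forward translates occur, so an average in a direction of a convex cone, based at a
  point of the cone, never leaves the cone.\<close>

definition avg :: "nat \<Rightarrow> 'a::real_vector \<Rightarrow> ('a \<Rightarrow> 'b::real_vector) \<Rightarrow> 'a \<Rightarrow> 'b" where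
  "avg N a g x = (\<Sum>j<N. g (x + real j *\<^sub>R a)) /\<^sub>R real N"

lemma norm_avg_le:
  fixes g :: "'a::real_vector \<Rightarrow> 'b::real_normed_vector"
  assumes "N > 0" "\<And>j. j < N \<Longrightarrow> norm (g (x + real j *\<^sub>R a)) \<le> r"
  shows "norm (avg N a g x) \<le> r"
proof -
  have "norm (\<Sum>j<N. g (x + real j *\<^sub>R a)) \<le> real (card {..<N}) * r"
    using assms(2) by (intro sum_norm_bound) auto
  then show ?thesis using \<open>N > 0\<close> by (simp add: avg_def field_simps)
qed

lemma avg_diff: "avg N a g x - avg N a h x = avg N a (\<lambda>y. g y - h y) x"
  by (simp add: avg_def sum_subtractf scaleR_diff_right)

lemma avg_const: "N > 0 \<Longrightarrow> avg N a (\<lambda>_. c) x = c"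
  by (simp add: avg_def sum_constant_scaleR)

lemma avg_translate: "avg N a g (x + u) = avg N a (\<lambda>y. g (y + u)) x"
  by (simp add: avg_def add_ac)

text \<open>Moving the base point by \<open>a\<close> shifts the summation index by one, so only the
  two end terms survive. The factor \<open>1 / N\<close> is what makes averages nearly
  additive.\<close>

lemma avg_increment:
  assumes "N > 0"
  shows "avg N a g (x + a) - avg N a g x = (g (x + real N *\<^sub>R a) - g x) /\<^sub>R real N"
proof -
  have "(\<Sum>j<N. g (x + a + real j *\<^sub>R a)) - (\<Sum>j<N. g (x + real j *\<^sub>R a))
      = (\<Sum>j<N. g (x + real (Suc j) *\<^sub>R a) - g (x + real j *\<^sub>R a))"
    by (simp add: sum_subtractf algebra_simps)
  also have "\<dots> = g (x + real N *\<^sub>R a) - g x"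
    by (subst sum_lessThan_telescope) simp
  finally show ?thesis
    by (simp add: avg_def scaleR_diff_right[symmetric])
qed

lemma avg_in_subspace:
  assumes "subspace S" "\<And>y. g y \<in> S"
  shows "avg N a g x \<in> S"
  unfolding avg_def using assms by (intro subspace_scale subspace_sum) auto

text \<open>
  The index \<open>n\<close> stands for the scale \<open>x \<mapsto> n *\<^sub>R R (x /\<^sub>R n)\<close>. The last clause survives averaging
  in every direction; exact identity on \<open>C\<close> would not.
\<close>

definition coarse_retractions ::
  "real \<Rightarrow> 'a::real_normed_vector set \<Rightarrow> 'a set \<Rightarrow> (nat \<Rightarrow> 'a \<Rightarrow> 'a) \<Rightarrow> bool" where
  "coarse_retractions L S C G \<longleftrightarrow>
     (\<forall>n x. G n x \<in> S) \<and> (\<forall>n x y. norm (G n x - G n y) \<le> L * norm (x - y)) \<and>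
     (\<exists>r. \<forall>c\<in>C. \<forall>\<^sub>F n in sequentially. norm (G n c - c) \<le> r)"

text \<open>Averaging commutes with translations and differences, so the Lipschitz constant is kept.
  The distance bound on \<open>C\<close> worsens by \<open>L * (N * norm a)\<close>, which depends
  neither on the point nor on \<open>n\<close>.\<close>

lemma coarse_retractions_avg:
  assumes "subspace S" "L \<ge> 0" "N > 0" and G: "coarse_retractions L S C G"
  shows "coarse_retractions L S C (\<lambda>n. avg N a (G n))"
proof -
  have lip: "norm (G n x - G n y) \<le> L * norm (x - y)" for n x y
    using G by (simp add: coarse_retractions_def)
  obtain r where r: "\<And>c. c \<in> C \<Longrightarrow> \<forall>\<^sub>F n in sequentially. norm (G n c - c) \<le> r"
    using G unfolding coarse_retractions_def by blast
  have "norm (avg N a (G n) x - avg N a (G n) y) \<le> L * norm (x - y)" for n x y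
  proof -
    have "avg N a (G n) x - avg N a (G n) y = avg N a (\<lambda>u. G n (u + x) - G n (u + y)) 0"
      using avg_translate[of N a "G n" 0 x] avg_translate[of N a "G n" 0 y]
      by (simp add: avg_diff)
    also have "norm \<dots> \<le> L * norm (x - y)"
    proof (rule norm_avg_le[OF \<open>N > 0\<close>])
      fix j
      show "norm (G n (0 + real j *\<^sub>R a + x) - G n (0 + real j *\<^sub>R a + y)) \<le> L * norm (x - y)"
        using lip[of n "0 + real j *\<^sub>R a + x" "0 + real j *\<^sub>R a + y"] by simp
    qed
    finally show ?thesis .
  qed
  moreover have "\<forall>\<^sub>F n in sequentially. norm (avg N a (G n) c - c) \<le> r + L * (N * norm a)"
    if "c \<in> C" for c
    using r[OF that]
  proof eventually_elim
    case (elim n)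
    have "avg N a (G n) c - c = avg N a (\<lambda>y. G n y - c) c"
      using avg_const[OF \<open>N > 0\<close>, of a c c] avg_diff[of N a "G n" c "\<lambda>_. c"] by simp
    also have "norm \<dots> \<le> r + L * (N * norm a)"
    proof (rule norm_avg_le[OF \<open>N > 0\<close>])
      fix j assume "j < N"
      have "norm (G n (c + real j *\<^sub>R a) - c)
          \<le> norm (G n (c + real j *\<^sub>R a) - G n c) + norm (G n c - c)"
        using norm_triangle_ineq[of "G n (c + real j *\<^sub>R a) - G n c" "G n c - c"] by simp
      also have "norm (G n (c + real j *\<^sub>R a) - G n c) \<le> L * (j * norm a)"
        using lip[of n "c + real j *\<^sub>R a" c] by simp
      also have "\<dots> \<le> L * (N * norm a)"
        using \<open>j < N\<close> \<open>L \<ge> 0\<close> by (intro mult_left_mono mult_right_mono) auto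
      finally show "norm (G n (c + real j *\<^sub>R a) - c) \<le> r + L * (N * norm a)"
        using elim by linarith
    qed
    finally show ?case .
  qed
  ultimately show ?thesis
    using G avg_in_subspace[OF \<open>subspace S\<close>, of "G _"] unfolding coarse_retractions_def by blast
qed

text \<open>For \<open>w = 0\<close> this is near additivity of \<open>g - g 0\<close> in direction
  \<open>a\<close>. All base points are included because averaging in another direction moves the
  base point.\<close>

definition almost_periodic_increments ::
  "real \<Rightarrow> 'a::real_normed_vector \<Rightarrow> ('a \<Rightarrow> 'b::real_normed_vector) \<Rightarrow> bool" where
  "almost_periodic_increments \<epsilon> a g \<longleftrightarrow>
     (\<forall>w x. norm ((g (w + x + a) - g (w + a)) - (g (w + x) - g w)) \<le> \<epsilon> * norm x)"

text \<open>The expression is linear in \<open>g\<close> and its bound is uniform in the base point,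
  so what was gained in direction \<open>a\<close> survives an average in direction
  \<open>b\<close>.\<close>

lemma almost_periodic_increments_avg:
  assumes "N > 0" "almost_periodic_increments \<epsilon> a g"
  shows "almost_periodic_increments \<epsilon> a (avg N b g)"
  unfolding almost_periodic_increments_def
proof (intro allI)
  fix w x
  have "(avg N b g (w + x + a) - avg N b g (w + a)) - (avg N b g (w + x) - avg N b g w)
      = avg N b (\<lambda>y. (g (y + x + a) - g (y + a)) - (g (y + x) - g y)) w"
    by (simp add: avg_translate avg_diff)
  also have "norm \<dots> \<le> \<epsilon> * norm x"
    using assms by (intro norm_avg_le) (auto simp: almost_periodic_increments_def)
  finally show "norm ((avg N b g (w + x + a) - avg N b g (w + a))
      - (avg N b g (w + x) - avg N b g w)) \<le> \<epsilon> * norm x" .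
qed

text \<open>The mixed second difference is symmetric in \<open>x\<close> and \<open>a\<close>. Read
  as an increment along \<open>a\<close>, it telescopes to two increments of \<open>g\<close> by
  \<open>x\<close>, each at most \<open>L * norm x\<close>, divided by \<open>N\<close>.\<close>

lemma almost_periodic_increments_avg_self:
  assumes lip: "\<And>x y. norm (g x - g y) \<le> L * norm (x - y)"
    and "N > 0" "2 * L \<le> \<epsilon> * real N"
  shows "almost_periodic_increments \<epsilon> a (avg N a g)"
  unfolding almost_periodic_increments_def
proof (intro allI)
  fix w x
  let ?d = "\<lambda>y. g (y + x) - g y"
  have "(avg N a g (w + x + a) - avg N a g (w + a)) - (avg N a g (w + x) - avg N a g w)
      = (avg N a g (w + x + a) - avg N a g (w + x)) - (avg N a g (w + a) - avg N a g w)"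
    by simp
  also have "\<dots> = (?d (w + real N *\<^sub>R a) - ?d w) /\<^sub>R real N"
    unfolding avg_increment[OF \<open>N > 0\<close>] by (simp add: algebra_simps)
  finally have "norm ((avg N a g (w + x + a) - avg N a g (w + a))
      - (avg N a g (w + x) - avg N a g w)) = norm (?d (w + real N *\<^sub>R a) - ?d w) / real N"
    by (simp add: divide_inverse mult.commute)
  also have "norm (?d (w + real N *\<^sub>R a) - ?d w) \<le> 2 * L * norm x"
    using norm_triangle_ineq4[of "?d (w + real N *\<^sub>R a)" "?d w"]
      lip[of "w + real N *\<^sub>R a + x" "w + real N *\<^sub>R a"] lip[of "w + x" w] by simp
  also have "2 * L * norm x / real N \<le> \<epsilon> * norm x"
    using mult_right_mono[OF assms(3), of "norm x"] \<open>N > 0\<close> by (simp add: field_simps)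
  finally show "norm ((avg N a g (w + x + a) - avg N a g (w + a))
      - (avg N a g (w + x) - avg N a g w)) \<le> \<epsilon> * norm x"
    using \<open>N > 0\<close> by (simp add: divide_right_mono)
qed

lemma exists_coarse_retractions_almost_periodic:
  assumes "subspace S" "L \<ge> 0" "\<epsilon> > 0" "finite A" and F: "coarse_retractions L S C F"
  shows "\<exists>G. coarse_retractions L S C G \<and> (\<forall>a\<in>A. \<forall>n. almost_periodic_increments \<epsilon> a (G n))"
  using \<open>finite A\<close>
proof induction
  case empty
  then show ?case using F by auto
next
  case (insert a A)
  then obtain G where G: "coarse_retractions L S C G"
    and A: "\<And>b n. b \<in> A \<Longrightarrow> almost_periodic_increments \<epsilon> b (G n)" by auto
  obtain N :: nat where N: "N > 0" "2 * L / \<epsilon> \<le> real N"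
    by (meson order.trans real_arch_simple less_imp_le of_nat_le_iff zero_less_Suc le_SucI order_refl)
  have N': "2 * L \<le> \<epsilon> * real N" using N \<open>\<epsilon> > 0\<close> by (simp add: field_simps)
  have "almost_periodic_increments \<epsilon> a (avg N a (G n))" for n
    by (rule almost_periodic_increments_avg_self[OF _ N(1) N'])
       (use G in \<open>simp add: coarse_retractions_def\<close>)
  then show ?case
    using coarse_retractions_avg[OF assms(1,2) N(1) G, of a]
      almost_periodic_increments_avg[OF N(1) A]
    by (intro exI[of _ "\<lambda>n. avg N a (G n)"]) auto
qed

text \<open>The directions in \<open>A\<close> come first. For each further direction in
  \<open>B\<close>, the distance bound \<open>r\<close> of the maps reached so far may be large, but
  it is fixed before \<open>N\<close> is chosen with \<open>2 * r / N \<le> \<epsilon>\<close>.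
  Later averages keep the earlier gains.\<close>

lemma exists_coarse_retractions_almost_equivariant:
  assumes S: "subspace S" and L: "L \<ge> 0" and \<epsilon>: "\<epsilon> > 0"
    and A: "finite A" and B: "finite B" "B \<subseteq> C" and C: "convex C" "cone C"
    and F: "coarse_retractions L S C F"
  shows "\<exists>G. coarse_retractions L S C G \<and> (\<forall>a\<in>A. \<forall>n. almost_periodic_increments \<epsilon> a (G n)) \<and>
    (\<forall>b\<in>B. \<forall>c\<in>C. \<forall>\<^sub>F n in sequentially. norm (G n (c + b) - G n c - b) \<le> \<epsilon>)"
  using B
proof induction
  case empty
  then show ?case using exists_coarse_retractions_almost_periodic[OF S L \<epsilon> A F] by auto
next
  case (insert b B)
  have C_add: "c + d \<in> C" and C_scale: "t \<ge> 0 \<Longrightarrow> t *\<^sub>R c \<in> C" if "c \<in> C" "d \<in> C" for c d t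
    using C that convex_cone[of C] by auto
  have b: "b \<in> C" using insert by auto
  from insert obtain G where G: "coarse_retractions L S C G"
    and GA: "\<And>a n. a \<in> A \<Longrightarrow> almost_periodic_increments \<epsilon> a (G n)"
    and GB: "\<And>b' c. b' \<in> B \<Longrightarrow> c \<in> C \<Longrightarrow>
      \<forall>\<^sub>F n in sequentially. norm (G n (c + b') - G n c - b') \<le> \<epsilon>" by auto
  obtain r where r: "\<And>c. c \<in> C \<Longrightarrow> \<forall>\<^sub>F n in sequentially. norm (G n c - c) \<le> r"
    using G unfolding coarse_retractions_def by blast
  obtain N :: nat where N: "N > 0" "2 * r / \<epsilon> \<le> real N"
    by (meson order.trans real_arch_simple less_imp_le of_nat_le_iff zero_less_Suc le_SucI order_refl)
  have "\<forall>\<^sub>F n in sequentially. norm (avg N b (G n) (c + b) - avg N b (G n) c - b) \<le> \<epsilon>"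
    if c: "c \<in> C" for c
    using r[OF c] r[OF C_add[OF c C_scale[OF b b, of "real N"]], simplified]
  proof eventually_elim
    case (elim n)
    let ?e = "\<lambda>x. G n x - x"
    have "avg N b (G n) (c + b) - avg N b (G n) c - b
        = (G n (c + real N *\<^sub>R b) - G n c) /\<^sub>R real N - (real N *\<^sub>R b) /\<^sub>R real N"
      unfolding avg_increment[OF N(1)] using N(1) by simp
    also have "\<dots> = (?e (c + real N *\<^sub>R b) - ?e c) /\<^sub>R real N"
      unfolding scaleR_diff_right[symmetric] by simp
    also have "norm \<dots> = norm (?e (c + real N *\<^sub>R b) - ?e c) / real N"
      by (simp add: divide_inverse mult.commute)
    also have "\<dots> \<le> (2 * r) / real N"
      using norm_triangle_ineq4[of "?e (c + real N *\<^sub>R b)" "?e c"] elim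
      by (intro divide_right_mono) auto
    also have "\<dots> \<le> \<epsilon>" using N \<epsilon> by (simp add: field_simps)
    finally show ?case .
  qed
  moreover have "\<forall>\<^sub>F n in sequentially. norm (avg N b (G n) (c + b') - avg N b (G n) c - b') \<le> \<epsilon>"
    if "c \<in> C" "b' \<in> B" for c b'
  proof -
    \<comment> \<open>Only finitely many translates occur, all in \<open>C\<close>, so they share a
      threshold for \<open>n\<close>.\<close>
    have "\<forall>\<^sub>F n in sequentially. \<forall>j\<in>{..<N}.
      norm (G n (c + real j *\<^sub>R b + b') - G n (c + real j *\<^sub>R b) - b') \<le> \<epsilon>"
      using that b by (intro eventually_ball_finite ballI GB C_add C_scale) auto
    then show ?thesis
    proof eventually_elim
      case (elim n)
      have "avg N b (G n) (c + b') - avg N b (G n) c - b'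
          = avg N b (\<lambda>y. G n (y + b') - G n y - b') c"
        using avg_const[OF N(1), of b b' c]
        by (simp add: avg_translate avg_diff[symmetric])
      then show ?case using elim by (auto intro!: norm_avg_le[OF N(1)])
    qed
  qed
  ultimately show ?case
    using coarse_retractions_avg[OF S L N(1) G, of b]
      almost_periodic_increments_avg[OF N(1) GA]
    by (intro exI[of _ "\<lambda>n. avg N b (G n)"]) auto
qed

text \<open>Only finitely many directions and points are prescribed, so a single large index of the
  sequence serves them all.\<close>

lemma almost_linear_retraction:
  fixes K :: "'a::real_normed_vector set"
  assumes K: "convex K" "0 \<in> K" and R: "lipschitz_retraction L K R"
    and "finite A" "finite B" "B \<subseteq> K" "\<epsilon> > 0"
  obtains H where "\<And>x. H x \<in> span K" "\<And>x. norm (H x) \<le> L * norm x"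
    "\<And>a x. a \<in> A \<Longrightarrow> norm (H (x + a) - H x - H a) \<le> \<epsilon> * norm x"
    "\<And>b. b \<in> B \<Longrightarrow> norm (H b - b) \<le> \<epsilon>"
proof -
  let ?C = "cone hull K"
  \<comment> \<open>Conjugating with a dilation keeps the Lipschitz constant; \<open>Suc n\<close>
    avoids the scale zero.\<close>
  define F where "F n x = real (Suc n) *\<^sub>R R (x /\<^sub>R real (Suc n))" for n x
  have lip: "L-lipschitz_on UNIV R" and R_K: "\<And>x. R x \<in> K" and R_id: "\<And>x. x \<in> K \<Longrightarrow> R x = x"
    using R by (auto simp: lipschitz_retraction_def)
  have "L \<ge> 0" using lip by (rule lipschitz_on_nonneg)
  have "norm (F n x - F n y) \<le> L * norm (x - y)" for n x y
  proof -
    have "norm (R (x /\<^sub>R real (Suc n)) - R (y /\<^sub>R real (Suc n))) \<le> L * (norm (x - y) / real (Suc n))"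
      using lipschitz_onD[OF lip, of "x /\<^sub>R real (Suc n)" "y /\<^sub>R real (Suc n)"]
      by (simp add: dist_norm scaleR_diff_right[symmetric] divide_inverse mult.commute)
    then have "real (Suc n) * norm (R (x /\<^sub>R real (Suc n)) - R (y /\<^sub>R real (Suc n)))
        \<le> L * norm (x - y)"
      by (simp add: field_simps del: of_nat_Suc)
    then show ?thesis
      by (simp add: F_def scaleR_diff_right[symmetric] del: of_nat_Suc)
  qed
  moreover have "\<forall>\<^sub>F n in sequentially. norm (F n c - c) \<le> 0" if c: "c \<in> ?C" for c
  proof -
    obtain t k where t: "c = t *\<^sub>R k" "t \<ge> 0" "k \<in> K"
      using c unfolding cone_hull_expl by blast
    obtain m :: nat where m: "t \<le> real m" using real_arch_simple by blast
    show ?thesis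
    proof (rule eventually_sequentiallyI[of m])
      fix n assume "m \<le> n"
      then have "t / real (Suc n) \<le> 1" using m by simp
      \<comment> \<open>At scales of at least \<open>t\<close>, the rescaled \<open>c\<close> is a
        convex combination of \<open>0\<close> and \<open>k\<close>; it lies in \<open>K\<close> and
        \<open>R\<close> fixes it.\<close>
      then have "(1 - t / real (Suc n)) *\<^sub>R 0 + (t / real (Suc n)) *\<^sub>R k \<in> K"
        using K t by (intro convexD) auto
      then have "c /\<^sub>R real (Suc n) \<in> K"
        by (simp add: t(1) divide_inverse mult.commute del: of_nat_Suc)
      then show "norm (F n c - c) \<le> 0" by (simp add: F_def R_id del: of_nat_Suc)
    qed
  qed
  moreover have "F n x \<in> span K" for n x
    unfolding F_def by (intro span_scale span_base R_K)
  ultimately have F: "coarse_retractions L (span K) ?C F"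
    unfolding coarse_retractions_def by blast
  have KC: "K \<subseteq> ?C" by (rule hull_subset)
  then have "B \<subseteq> ?C" "0 \<in> ?C" using assms by auto
  then obtain G where G: "coarse_retractions L (span K) ?C G"
    and GA: "\<And>a n. a \<in> A \<Longrightarrow> almost_periodic_increments \<epsilon> a (G n)"
    and GB: "\<And>b. b \<in> B \<Longrightarrow> \<forall>\<^sub>F n in sequentially. norm (G n (0 + b) - G n 0 - b) \<le> \<epsilon>"
    using exists_coarse_retractions_almost_equivariant[OF subspace_span \<open>L \<ge> 0\<close> \<open>\<epsilon> > 0\<close> \<open>finite A\<close>
        \<open>finite B\<close> _ convex_cone_hull[OF K(1)] cone_cone_hull F] by blast
  have "\<forall>\<^sub>F n in sequentially. \<forall>b\<in>B. norm (G n (0 + b) - G n 0 - b) \<le> \<epsilon>"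
    using GB \<open>finite B\<close> by (intro eventually_ball_finite) auto
  then obtain n where n: "\<And>b. b \<in> B \<Longrightarrow> norm (G n b - G n 0 - b) \<le> \<epsilon>"
    by (auto simp: eventually_sequentially)
  show ?thesis
  \<comment> \<open>Subtracting the value at \<open>0\<close> turns the Lipschitz bound into a norm
    bound and the increments at base point \<open>0\<close> into near additivity.\<close>
  proof (rule that[of "\<lambda>x. G n x - G n 0"])
    have GK: "G n u \<in> span K" and G_lip: "norm (G n u - G n v) \<le> L * norm (u - v)" for u v
      using G by (auto simp: coarse_retractions_def)
    show "G n x - G n 0 \<in> span K" "norm (G n x - G n 0) \<le> L * norm x" for x
      using G_lip[of x 0] by (simp_all add: span_diff GK)
    show "norm ((G n (x + a) - G n 0) - (G n x - G n 0) - (G n a - G n 0)) \<le> \<epsilon> * norm x"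
      if "a \<in> A" for a x
    proof -
      have "norm ((G n (0 + x + a) - G n (0 + a)) - (G n (0 + x) - G n 0)) \<le> \<epsilon> * norm x"
        using GA[OF that, of n] unfolding almost_periodic_increments_def by blast
      then show ?thesis by (simp add: algebra_simps)
    qed
  qed (rule n)
qed

section \<open>Duals and biduals of subspaces\<close>

lemma operator_norm_upper:
  assumes "bounded_operator V n m T" "\<And>x. x \<in> V \<Longrightarrow> 0 \<le> n x" "x \<in> V" "n x \<le> 1"
  shows "m (T x) \<le> operator_norm V n m T"
proof -
  obtain C where C: "\<And>x. x \<in> V \<Longrightarrow> m (T x) \<le> C * n x"
    using assms(1) by (auto simp: bounded_operator_def)
  have "m (T y) \<le> \<bar>C\<bar>" if "y \<in> V" "n y \<le> 1" for y
  proof -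
    have "C * n y \<le> \<bar>C\<bar> * 1"
      using that assms(2)[of y] by (intro mult_mono) auto
    with C[of y] that show ?thesis by simp
  qed
  then have "bdd_above ((\<lambda>x. m (T x)) ` {x \<in> V. n x \<le> 1})" by (auto intro!: bdd_aboveI2)
  then show ?thesis
    unfolding operator_norm_def using assms(3,4) by (intro cSUP_upper) auto
qed

text \<open>The point \<open>v\<close> keeps the supremum from being taken over the empty
  set.\<close>

lemma operator_norm_least:
  assumes "v \<in> V" "n v \<le> 1" "\<And>x. x \<in> V \<Longrightarrow> n x \<le> 1 \<Longrightarrow> m (T x) \<le> c"
  shows "operator_norm V n m T \<le> c"
  unfolding operator_norm_def using assms by (intro cSUP_least) auto

lemma dual_bounded: "f \<in> dual V n \<Longrightarrow> bounded_operator V n norm f"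
  unfolding dual_def by blast

lemma dual_norm_nonneg:
  assumes "f \<in> dual V n" "\<And>x. x \<in> V \<Longrightarrow> 0 \<le> n x" "v \<in> V" "n v \<le> 1"
  shows "0 \<le> dual_norm V n f"
proof -
  have "norm (f v) \<le> dual_norm V n f"
    unfolding dual_norm_def by (intro operator_norm_upper dual_bounded assms)
  then show ?thesis by (meson norm_ge_zero order_trans)
qed

lemma dual_linear: "f \<in> dual V n \<Longrightarrow> linear_map_on V f"
  by (simp add: dual_def bounded_operator_def)

lemma dual_apply_le:
  assumes V: "subspace V" and f: "f \<in> dual V norm" and x: "x \<in> V"
  shows "\<bar>f x\<bar> \<le> dual_norm V norm f * norm x"
proof (cases "x = 0")
  case True
  have "f (0 *\<^sub>R x) = 0 *\<^sub>R f x"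
    using dual_linear[OF f] x unfolding linear_map_on_def by blast
  then show ?thesis using True by simp
next
  case False
  have "norm (f (x /\<^sub>R norm x)) \<le> dual_norm V norm f"
    unfolding dual_norm_def
    using False x V by (intro operator_norm_upper dual_bounded f) (auto simp: subspace_scale)
  moreover have "f (x /\<^sub>R norm x) = f x /\<^sub>R norm x"
    using dual_linear[OF f] x unfolding linear_map_on_def by blast
  ultimately have "norm (f x /\<^sub>R norm x) \<le> dual_norm V norm f" by simp
  then show ?thesis using False by (simp add: abs_mult field_simps)
qed

lemma zero_in_dual: "0 \<in> dual V norm"
  by (auto simp: dual_def bounded_operator_def linear_map_on_def intro!: exI[of _ 0])

lemma dual_norm_zero:
  assumes "subspace V"
  shows "dual_norm V norm 0 = 0"
proof (rule antisym)
  show "dual_norm V norm 0 \<le> 0"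
    unfolding dual_norm_def
    by (rule operator_norm_least[of 0]) (use assms in \<open>auto simp: subspace_0\<close>)
  show "0 \<le> dual_norm V norm 0"
    by (rule dual_norm_nonneg[OF zero_in_dual, of _ 0]) (use assms in \<open>auto simp: subspace_0\<close>)
qed

lemma dual_add:
  assumes "f \<in> dual V norm" "g \<in> dual V norm"
  shows "f + g \<in> dual V norm"
proof -
  obtain C D where "\<And>x. x \<in> V \<Longrightarrow> norm (f x) \<le> C * norm x" "\<And>x. x \<in> V \<Longrightarrow> norm (g x) \<le> D * norm x"
    using assms unfolding dual_def bounded_operator_def by blast
  then have "norm (f x + g x) \<le> (C + D) * norm x" if "x \<in> V" for x
    using that norm_triangle_ineq[of "f x" "g x"] by (fastforce simp: algebra_simps)
  then have "\<exists>C. \<forall>x\<in>V. norm (f x + g x) \<le> C * norm x" by blast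
  then show ?thesis
    using assms by (auto simp: dual_def bounded_operator_def linear_map_on_def algebra_simps)
qed

lemma dual_scale:
  assumes "f \<in> dual V norm"
  shows "c *\<^sub>R f \<in> dual V norm"
proof -
  obtain C where "\<And>x. x \<in> V \<Longrightarrow> norm (f x) \<le> C * norm x"
    using assms by (auto simp: dual_def bounded_operator_def)
  then have "norm (c * f x) \<le> (\<bar>c\<bar> * C) * norm x" if "x \<in> V" for x
    using that mult_left_mono[of "norm (f x)" "C * norm x" "\<bar>c\<bar>"] by (simp add: abs_mult algebra_simps)
  then have "\<exists>C. \<forall>x\<in>V. norm (c * f x) \<le> C * norm x" by blast
  then show ?thesis
    using assms by (auto simp: dual_def bounded_operator_def linear_map_on_def scaleR_fun_def algebra_simps)
qed

text \<open>A norming functional of \<open>y\<close>, cut off outside \<open>V\<close>, lies in the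
  dual unit ball, and the embedded \<open>y\<close> takes the value \<open>norm y\<close> there. The
  bound yields injectivity of the embedding and the norm estimate for the final projection.\<close>

lemma norm_le_bidual_norm_canonical_embedding:
  assumes V: "subspace V" and y: "y \<in> V"
  shows "norm y \<le> bidual_norm V norm (canonical_embedding V norm y)"
proof -
  obtain f where f: "linear f" "\<And>x. \<bar>f x\<bar> \<le> norm x" "f y = norm y"
    using norming_functional by blast
  define g where "g x = (if x \<in> V then f x else 0)" for x
  have g: "g \<in> dual V norm"
    using f V by (auto simp: g_def dual_def bounded_operator_def linear_map_on_def linear_add
        linear_cmul subspace_add subspace_scale intro!: exI[of _ 1])
  have g1: "dual_norm V norm g \<le> 1"
    unfolding dual_norm_def
    by (rule operator_norm_least[of 0])
       (use V f(2) in \<open>auto simp: subspace_0 g_def intro: order_trans\<close>)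
  have "bounded_operator (dual V norm) (dual_norm V norm) norm (canonical_embedding V norm y)"
    unfolding bounded_operator_def linear_map_on_def
    using dual_apply_le[OF V _ y]
    dual_scale[of _ V, unfolded scaleR_fun_def real_scaleR_def]
    by (auto simp: canonical_embedding_def dual_add scaleR_fun_def mult.commute
        intro!: exI[of _ "norm y"])
  then have "norm (canonical_embedding V norm y g) \<le> bidual_norm V norm (canonical_embedding V norm y)"
    unfolding bidual_norm_def dual_norm_def[of "dual V norm"]
    by (rule operator_norm_upper)
       (use g g1 V subspace_0 in \<open>auto intro!: dual_norm_nonneg[of _ V norm 0]\<close>)
  then show ?thesis using g f(3) y by (simp add: canonical_embedding_def g_def)
qed

lemma canonical_embedding_add:
  "y \<in> V \<Longrightarrow> z \<in> V \<Longrightarrow>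
    canonical_embedding V n (y + z) = canonical_embedding V n y + canonical_embedding V n z"
  by (auto simp: canonical_embedding_def fun_eq_iff dual_def bounded_operator_def linear_map_on_def)

lemma canonical_embedding_scale:
  "y \<in> V \<Longrightarrow> canonical_embedding V n (c *\<^sub>R y) = c *\<^sub>R canonical_embedding V n y"
  by (auto simp: canonical_embedding_def fun_eq_iff dual_def bounded_operator_def linear_map_on_def
      scaleR_fun_def)

text \<open>The difference of two points with the same image embeds as zero, so the lower norm bound
  makes it vanish.\<close>

lemma inj_on_canonical_embedding:
  fixes V :: "'a::real_normed_vector set"
  assumes V: "subspace V"
  shows "inj_on (canonical_embedding V norm) V"
proof (rule inj_onI)
  fix y z assume yz: "y \<in> V" "z \<in> V" "canonical_embedding V norm y = canonical_embedding V norm z"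
  let ?J = "canonical_embedding V norm"
  have mem: "y + (-1) *\<^sub>R z \<in> V" using V yz by (intro subspace_add subspace_scale)
  have "?J (y + (-1) *\<^sub>R z) = 0"
    using yz V by (simp only: canonical_embedding_add canonical_embedding_scale subspace_scale) simp
  then have "bidual_norm V norm (?J (y + (-1) *\<^sub>R z)) \<le> 0"
    unfolding bidual_norm_def dual_norm_def[of "dual V norm"]
    by (intro operator_norm_least[OF zero_in_dual]) (simp_all add: dual_norm_zero[OF V])
  then have "norm (y + (-1) *\<^sub>R z) \<le> 0"
    by (rule order_trans[OF norm_le_bidual_norm_canonical_embedding[OF V mem]])
  then show "y = z" by simp
qed

section \<open>Passing to the weak-star limit\<close>

text \<open>The limit object satisfies estimates of every accuracy \<open>1 / Suc m\<close>; this
  turns them into identities.\<close>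

lemma eq_zero_if_le_divide_Suc:
  fixes t c :: real
  assumes "\<And>m::nat. \<bar>t\<bar> \<le> c / real (Suc m)"
  shows "t = 0"
proof -
  have "(\<lambda>m. c / real (Suc m)) \<longlonglongrightarrow> 0"
    using LIMSEQ_Suc[OF lim_const_over_n[of c]] by simp
  then have "\<bar>t\<bar> \<le> 0" by (rule LIMSEQ_le_const) (use assms in auto)
  then show ?thesis by simp
qed

text \<open>The limit is only seen to be additive in \<open>x\<close>, so homogeneity has to come
  from boundedness. The defect \<open>g\<close> is additive and vanishes on integers, hence
  \<open>Suc m * g c\<close> is \<open>g\<close> at a fractional part, bounded independently of
  \<open>m\<close>.\<close>

lemma linear_if_additive_bounded:
  fixes \<phi> :: "'a::real_normed_vector \<Rightarrow> real"
  assumes add: "\<And>x y. \<phi> (x + y) = \<phi> x + \<phi> y" and bound: "\<And>x. \<bar>\<phi> x\<bar> \<le> C * norm x"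
  shows "linear \<phi>"
proof
  fix c :: real and x
  define g where "g t = \<phi> (t *\<^sub>R x) - t * \<phi> x" for t
  have g_add: "g (s + t) = g s + g t" for s t
    by (simp add: g_def add scaleR_add_left algebra_simps)
  interpret g: additive g by standard (rule g_add)
  have g_nat: "g (real n * t) = real n * g t" for n t
    by (induction n) (simp_all add: g.zero g_add distrib_right)
  have "g 1 = 0" by (simp add: g_def)
  then have g_int: "g (of_int k) = 0" for k
    using g_nat[of _ 1] g.minus by (cases k rule: int_cases2) auto
  have "\<bar>g c\<bar> \<le> (2 * \<bar>C\<bar> * norm x) / real (Suc m)" for m
  proof -
    let ?s = "frac (real (Suc m) * c)"
    have "real (Suc m) * c = of_int \<lfloor>real (Suc m) * c\<rfloor> + ?s" by (simp add: frac_def)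
    then have g_s: "real (Suc m) * g c = g ?s"
      using g_nat[of "Suc m" c] g_add g_int by (metis add_0)
    have s: "0 \<le> ?s" "?s \<le> 1" by (simp_all add: frac_lt_1 less_imp_le)
    have "\<bar>\<phi> (t *\<^sub>R x)\<bar> \<le> \<bar>C\<bar> * norm x" if "0 \<le> t" "t \<le> 1" for t
    proof -
      have "\<bar>\<phi> (t *\<^sub>R x)\<bar> \<le> C * (t * norm x)" using bound[of "t *\<^sub>R x"] that by simp
      also have "\<dots> \<le> \<bar>C\<bar> * (1 * norm x)" using that by (intro mult_mono mult_right_mono) auto
      finally show ?thesis by simp
    qed
    from this[OF s] this[of 1] have "\<bar>\<phi> (?s *\<^sub>R x)\<bar> \<le> \<bar>C\<bar> * norm x" "\<bar>\<phi> x\<bar> \<le> \<bar>C\<bar> * norm x"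
      by simp_all
    moreover have "\<bar>?s * \<phi> x\<bar> \<le> 1 * \<bar>\<phi> x\<bar>"
      unfolding abs_mult using s by (intro mult_right_mono) auto
    ultimately have "\<bar>g ?s\<bar> \<le> 2 * \<bar>C\<bar> * norm x"
      unfolding g_def by linarith
    then have "real (Suc m) * \<bar>g c\<bar> \<le> 2 * \<bar>C\<bar> * norm x"
      unfolding g_s[symmetric] by (simp add: abs_mult)
    then show ?thesis by (simp add: field_simps)
  qed
  then have "g c = 0" by (rule eq_zero_if_le_divide_Suc)
  then show "\<phi> (c *\<^sub>R x) = c *\<^sub>R \<phi> x" by (simp add: g_def)
qed (rule add)

lemma compact_bounded_functions:
  fixes b :: "'i \<Rightarrow> real"
  shows "compact {\<Phi>. \<forall>i. \<bar>\<Phi> i\<bar> \<le> b i}"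
proof -
  have "{- b i .. b i} = {t. \<bar>t\<bar> \<le> b i}" for i by auto
  then have "PiE UNIV (\<lambda>i. {- b i .. b i}) = {\<Phi>. \<forall>i. \<bar>\<Phi> i\<bar> \<le> b i}"
    by (simp add: PiE_UNIV_domain Pi_def)
  moreover have "compactin (product_topology (\<lambda>_. euclidean) UNIV) (PiE UNIV (\<lambda>i. {- b i .. b i}))"
    by (auto simp: compactin_PiE)
  ultimately show ?thesis by (simp add: euclidean_product_topology)
qed

text \<open>A map into the bidual is treated as a function of pairs \<open>(x, f)\<close>, so
  weak-star compactness becomes compactness of a product of intervals. All requirements are closed
  conditions, and any finitely many are met through an almost linear \<open>H\<close>.\<close>

lemma linear_map_into_bidual:
  fixes Y K :: "'a::real_normed_vector set"
  assumes Y: "subspace Y" "closure (span K) = Y"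
    and K: "convex K" "0 \<in> K" and R: "lipschitz_retraction L K R"
  obtains W where "linear W" "\<And>x. W x \<in> bidual Y norm"
    "\<And>x. bidual_norm Y norm (W x) \<le> L * norm x"
    "\<And>y. y \<in> Y \<Longrightarrow> W y = canonical_embedding Y norm y"
proof -
  define D where "D = dual Y norm"
  define N where "N = dual_norm Y norm"
  \<comment> \<open>The bound \<open>0\<close> off the dual enforces that functionals vanish outside
    their domain.\<close>
  define b where "b = (\<lambda>(x :: 'a, f). if f \<in> D then L * norm x * N f else 0)"
  define E where "E = {\<Phi> :: 'a \<times> ('a \<Rightarrow> real) \<Rightarrow> real. \<forall>p. \<bar>\<Phi> p\<bar> \<le> b p}"
  \<comment> \<open>Here \<open>a\<close> is a direction of additivity, \<open>k\<close> a point of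
    \<open>K\<close> to be kept, and \<open>m\<close> the accuracy.\<close>
  define T where "T = (\<lambda>(a, k, m). {\<Phi> :: 'a \<times> ('a \<Rightarrow> real) \<Rightarrow> real.
      (\<forall>x f g. f \<in> D \<longrightarrow> g \<in> D \<longrightarrow> \<Phi> (x, f + g) = \<Phi> (x, f) + \<Phi> (x, g)) \<and>
      (\<forall>x f c. f \<in> D \<longrightarrow> \<Phi> (x, c *\<^sub>R f) = c * \<Phi> (x, f)) \<and>
      (\<forall>x f. f \<in> D \<longrightarrow> \<bar>\<Phi> (x + a, f) - \<Phi> (x, f) - \<Phi> (a, f)\<bar> \<le> N f * norm x / real (Suc m)) \<and>
      (\<forall>f. f \<in> D \<longrightarrow> \<bar>\<Phi> (k, f) - f k\<bar> \<le> N f / real (Suc m))})"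
  have L: "L \<ge> 0" using R lipschitz_on_nonneg by (auto simp: lipschitz_retraction_def)
  have N_nonneg: "N f \<ge> 0" if "f \<in> D" for f
    using that Y(1) dual_norm_nonneg[of f Y norm 0] by (auto simp: D_def N_def subspace_0)
  have apply_le: "\<bar>f y\<bar> \<le> N f * norm y" if "f \<in> D" "y \<in> Y" for f y
    using dual_apply_le[OF Y(1)] that by (simp add: D_def N_def)
  have diff: "f (y - z) = f y - f z" if "f \<in> D" "y \<in> Y" "z \<in> Y" for f y z
  proof -
    have "f (y + (-1) *\<^sub>R z) = f y + (-1) *\<^sub>R f z"
      using dual_linear[of f Y norm] that subspace_scale[OF Y(1)]
      unfolding D_def linear_map_on_def by metis
    then show ?thesis by simp
  qed
  have span_Y: "span K \<subseteq> Y" using Y(2) closure_subset by auto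
  have K_Y: "K \<subseteq> Y" using span_Y span_superset by auto
  have "E \<inter> \<Inter> (T ` (UNIV \<times> K \<times> UNIV)) \<noteq> {}"
  proof (rule compact_imp_fip)
    show "compact E" unfolding E_def by (rule compact_bounded_functions)
    show "closed S" if "S \<in> T ` (UNIV \<times> K \<times> UNIV)" for S
      using that unfolding T_def
      by (auto intro!: closed_Collect_all closed_Collect_conj closed_Collect_imp open_Collect_const
          closed_Collect_eq closed_Collect_le continuous_intros
          continuous_on_product_coordinates)
  next
    fix F' assume "finite F'" "F' \<subseteq> T ` (UNIV \<times> K \<times> UNIV)"
    then obtain I where I: "I \<subseteq> UNIV \<times> K \<times> UNIV" "finite I" and F': "F' = T ` I"
      by (meson finite_subset_image)
    have "finite ((snd \<circ> snd) ` I)" using I(2) by (rule finite_imageI)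
    \<comment> \<open>\<open>M\<close> dominates all accuracies in \<open>I\<close>, so the error
      \<open>1 / Suc M\<close> suffices for each condition.\<close>
    then obtain M where M: "\<forall>m\<in>(snd \<circ> snd) ` I. m \<le> M"
      unfolding finite_nat_set_iff_bounded_le by blast
    have B: "(fst \<circ> snd) ` I \<subseteq> K" using I(1) by auto
    obtain H where H: "\<And>x. H x \<in> span K" "\<And>x. norm (H x) \<le> L * norm x"
      "\<And>a x. a \<in> fst ` I \<Longrightarrow> norm (H (x + a) - H x - H a) \<le> (1 / real (Suc M)) * norm x"
      "\<And>k. k \<in> (fst \<circ> snd) ` I \<Longrightarrow> norm (H k - k) \<le> 1 / real (Suc M)"
      by (rule almost_linear_retraction[OF K R finite_imageI[OF I(2), of fst]
            finite_imageI[OF I(2), of "fst \<circ> snd"] B, of "1 / real (Suc M)"]) auto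
    have HY: "H x \<in> Y" for x using H(1) span_Y by auto
    \<comment> \<open>Evaluation at \<open>H x\<close> is exactly linear in \<open>f\<close>,
      although \<open>H\<close> is only almost additive.\<close>
    define \<Phi> where "\<Phi> = (\<lambda>(x, f). if f \<in> D then f (H x) else 0)"
    have "\<Phi> \<in> E"
    proof -
      have "\<bar>f (H x)\<bar> \<le> L * norm x * N f" if "f \<in> D" for f x
        using apply_le[OF that HY[of x]] mult_left_mono[OF H(2)[of x] N_nonneg[OF that]]
        by (simp add: mult.commute)
      then show ?thesis by (auto simp: E_def \<Phi>_def b_def)
    qed
    moreover have "\<Phi> \<in> T i" if "i \<in> I" for i
    proof -
      obtain a k m where i: "i = (a, k, m)" by (metis prod_cases3)
      have a: "a \<in> fst ` I" and k: "k \<in> (fst \<circ> snd) ` I" and "m \<in> (snd \<circ> snd) ` I"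
        using that i by force+
      then have m: "1 / real (Suc M) \<le> 1 / real (Suc m)"
        using M by (intro divide_left_mono) auto
      have "k \<in> Y" using k B K_Y by auto
      have "\<bar>f (H (x + a)) - f (H x) - f (H a)\<bar> \<le> N f * norm x / real (Suc m)" if f: "f \<in> D" for f x
      proof -
        have "\<bar>f (H (x + a)) - f (H x) - f (H a)\<bar> = \<bar>f (H (x + a) - H x - H a)\<bar>"
          using HY f Y(1) by (simp add: diff subspace_diff)
        also have "\<dots> \<le> N f * norm (H (x + a) - H x - H a)"
          using HY f Y(1) by (intro apply_le subspace_diff)
        also have "\<dots> \<le> N f * ((1 / real (Suc m)) * norm x)"
          using H(3)[OF a, of x] mult_right_mono[OF m, of "norm x"] N_nonneg[OF f]
          by (intro mult_left_mono) auto
        finally show ?thesis by simp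
      qed
      moreover have "\<bar>f (H k) - f k\<bar> \<le> N f / real (Suc m)" if f: "f \<in> D" for f
      proof -
        have "\<bar>f (H k) - f k\<bar> = \<bar>f (H k - k)\<bar>" using HY f \<open>k \<in> Y\<close> by (simp add: diff)
        also have "\<dots> \<le> N f * norm (H k - k)"
          using HY f Y(1) \<open>k \<in> Y\<close> by (intro apply_le subspace_diff)
        also have "\<dots> \<le> N f * (1 / real (Suc m))"
          using H(4)[OF k] m N_nonneg[OF f] by (intro mult_left_mono) auto
        finally show ?thesis by simp
      qed
      ultimately show ?thesis
        using dual_add[of _ Y] dual_scale[of _ Y]
        by (auto simp: T_def i \<Phi>_def scaleR_fun_def D_def simp del: of_nat_Suc)
    qed
    ultimately show "E \<inter> \<Inter> F' \<noteq> {}" unfolding F' by blast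
  qed
  then obtain \<Phi> where \<Phi>E: "\<Phi> \<in> E" and \<Phi>T: "\<And>a k m. k \<in> K \<Longrightarrow> \<Phi> \<in> T (a, k, m)" by blast
  define W where "W x f = \<Phi> (x, f)" for x f
  \<comment> \<open>The point \<open>0\<close> of \<open>K\<close> serves wherever only the first
    three clauses are wanted.\<close>
  have T0: "\<Phi> \<in> T (a, 0, m)" for a m using \<Phi>T K(2) by blast
  have W_le: "\<bar>W x f\<bar> \<le> (if f \<in> D then L * norm x * N f else 0)" for x f
    using \<Phi>E by (simp add: E_def W_def b_def)
  have W_bound: "\<bar>W x f\<bar> \<le> L * norm x * N f" if "f \<in> D" for x f
    using W_le[of x f] that by simp
  have W_outside: "W x f = 0" if "f \<notin> D" for x f
    using W_le[of x f] that by simp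
  have W_D_add: "W x (f + g) = W x f + W x g" and W_D_scale: "W x (c *\<^sub>R f) = c * W x f"
    if "f \<in> D" "g \<in> D" for x f g c
    using T0[of 0 0] that by (auto simp: T_def W_def)
  have W_linear_f: "linear (\<lambda>x. W x f)" for f
  proof (cases "f \<in> D")
    case True
    have "W (x + a) f = W x f + W a f" for x a
    proof -
      have "W (x + a) f - W x f - W a f = 0"
        by (rule eq_zero_if_le_divide_Suc[of _ "N f * norm x"])
           (use T0[of a] True in \<open>simp add: T_def W_def del: of_nat_Suc\<close>)
      then show ?thesis by simp
    qed
    then show ?thesis
      by (rule linear_if_additive_bounded[of _ "L * N f"])
         (use W_bound[OF True] in \<open>simp add: mult_ac\<close>)
  next
    case False
    then show ?thesis by (simp add: W_outside linear_zero)
  qed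
  have "linear W"
    by standard (auto simp: fun_eq_iff scaleR_fun_def linear_add[OF W_linear_f]
        linear_cmul[OF W_linear_f])
  moreover have "W x \<in> bidual Y norm" for x
    unfolding bidual_def dual_def[of "dual Y norm"] bounded_operator_def linear_map_on_def
    using W_bound[of _ x] W_D_add[of _ _ x] W_D_scale[of _ _ x] W_outside[of _ x]
    by (auto simp: D_def N_def intro!: exI[of _ "L * norm x"])
  moreover have "bidual_norm Y norm (W x) \<le> L * norm x" for x
    unfolding bidual_norm_def dual_norm_def[of "dual Y norm"]
  proof (rule operator_norm_least[OF zero_in_dual])
    show "dual_norm Y norm 0 \<le> 1" by (simp add: dual_norm_zero[OF Y(1)])
    fix f assume "f \<in> dual Y norm" "dual_norm Y norm f \<le> 1"
    then show "norm (W x f) \<le> L * norm x"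
      using W_bound[of f x] mult_left_mono[of "N f" 1 "L * norm x"] L by (simp add: D_def N_def)
  qed
  moreover have "W y = canonical_embedding Y norm y" if y: "y \<in> Y" for y
  proof
    fix f
    show "W y f = canonical_embedding Y norm y f"
    proof (cases "f \<in> D")
      case f: True
      have W_K: "W k f = f k" if "k \<in> K" for k
      proof -
        have "W k f - f k = 0"
          by (rule eq_zero_if_le_divide_Suc[of _ "N f"])
             (use \<Phi>T[OF that, of 0] f in \<open>simp add: T_def W_def del: of_nat_Suc\<close>)
        then show ?thesis by simp
      qed
      have f_lin: "f (u + v) = f u + f v" "f (c *\<^sub>R u) = c * f u" if "u \<in> Y" "v \<in> Y" for u v c
        using dual_linear[of f Y norm] f that by (auto simp: D_def linear_map_on_def)
      have "s \<in> {s \<in> Y. W s f = f s}" if "s \<in> span K" for s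
      proof (rule subsetD[OF span_minimal that])
        show "K \<subseteq> {s \<in> Y. W s f = f s}" using W_K K_Y by auto
        show "subspace {s \<in> Y. W s f = f s}"
        proof (rule subspaceI)
          show "0 \<in> {s \<in> Y. W s f = f s}" using W_K[OF K(2)] subspace_0[OF Y(1)] by simp
        qed (auto simp: f_lin linear_add[OF W_linear_f] linear_cmul[OF W_linear_f]
              subspace_add[OF Y(1)] subspace_scale[OF Y(1)])
      qed
      then have W_span: "W s f = f s" if "s \<in> span K" for s using that by auto
      have "W y f - f y = 0"
      proof (rule eq_zero_if_le_divide_Suc)
        fix m :: nat
        have "y \<in> closure (span K)" using y Y(2) by simp
        then obtain s where s: "s \<in> span K" "dist s y < 1 / real (Suc m)"
          unfolding closure_approachable by (meson divide_pos_pos of_nat_0_less_iff zero_less_Suc zero_less_one)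
        then have sY: "s \<in> Y" using span_Y by auto
        \<comment> \<open>\<open>W\<close> and \<open>f\<close> agree at the nearby point
          \<open>s\<close>, so the defect at \<open>y\<close> is the defect at \<open>y - s\<close>,
          which is small because both are bounded.\<close>
        have "W y f - f y = W (y - s) f - f (y - s)"
          using W_span[OF s(1)] by (simp add: linear_diff[OF W_linear_f] diff f y sY)
        also have "\<bar>\<dots>\<bar> \<le> L * norm (y - s) * N f + N f * norm (y - s)"
          using W_bound[OF f, of "y - s"] apply_le[OF f subspace_diff[OF Y(1) y sY]] by linarith
        also have "\<dots> = ((L + 1) * N f) * norm (y - s)" by (simp add: algebra_simps)
        also have "\<dots> \<le> ((L + 1) * N f) * (1 / real (Suc m))"
          using s(2) L N_nonneg[OF f]
          by (intro mult_left_mono) (auto simp: dist_norm norm_minus_commute)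
        finally show "\<bar>W y f - f y\<bar> \<le> ((L + 1) * N f) / real (Suc m)" by simp
      qed
      then show ?thesis using f by (simp add: canonical_embedding_def D_def)
    next
      case False
      then show ?thesis by (simp add: W_outside canonical_embedding_def D_def)
    qed
  qed
  ultimately show ?thesis using that by blast
qed

section \<open>Composition with the projection of the bidual\<close>

theorem theorem4p10:
  fixes Y K :: "'a::banach set" and l\<^sub>1 l\<^sub>2 :: real
  assumes "l\<^sub>1 > 0" and "l\<^sub>2 > 0"
    and "subspace Y" and "closed Y"
    and "complemented_in_bidual l\<^sub>1 Y"
    and "convex K" and "0 \<in> K" and "closure (span K) = Y"
    and "\<exists>R. lipschitz_retraction l\<^sub>2 K R"
  shows "complemented (l\<^sub>1 * l\<^sub>2) Y UNIV norm"
proof -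
  let ?J = "canonical_embedding Y norm" and ?Z = "bidual Y norm" and ?n = "bidual_norm Y norm"
  note Y = \<open>subspace Y\<close>
  obtain W where W: "linear W" "\<And>x. W x \<in> ?Z" "\<And>x. ?n (W x) \<le> l\<^sub>2 * norm x"
    "\<And>y. y \<in> Y \<Longrightarrow> W y = ?J y"
    using assms linear_map_into_bidual by metis
  obtain P where P: "bounded_operator ?Z ?n ?n P" "operator_norm ?Z ?n ?n P \<le> l\<^sub>1"
    "P ` ?Z = ?J ` Y" "\<And>z. z \<in> ?J ` Y \<Longrightarrow> P z = z"
    using assms(5) unfolding complemented_in_bidual_def complemented_def by blast
  \<comment> \<open>\<open>P\<close> maps into the embedded copy of \<open>Y\<close>, where the
    injective embedding can be inverted.\<close>
  define Q where "Q x = inv_into Y ?J (P (W x))" for x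
  have PW: "P (W x) \<in> ?J ` Y" for x using P(3) W(2) by blast
  have QY: "Q x \<in> Y" and JQ: "?J (Q x) = P (W x)" for x
    unfolding Q_def using PW by (auto intro: inv_into_into f_inv_into_f)
  \<comment> \<open>By injectivity, identities for \<open>Q\<close> need only be checked in the
    bidual.\<close>
  have Q_eqI: "Q x = y" if "y \<in> Y" "?J y = P (W x)" for x y
    using inj_onD[OF inj_on_canonical_embedding[OF Y] _ QY that(1)] JQ that(2) by metis
  have Q_id: "Q y = y" if "y \<in> Y" for y
    using that W(4) P(4) by (intro Q_eqI) auto
  have P_lin: "linear_map_on ?Z P" using P(1) by (simp add: bounded_operator_def)
  have "linear Q"
  proof
    fix x y
    have "P (W (x + y)) = P (W x) + P (W y)"
      using P_lin W(2) unfolding linear_map_on_def linear_add[OF W(1)] by blast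
    then show "Q (x + y) = Q x + Q y"
      using QY JQ by (intro Q_eqI) (auto simp: canonical_embedding_add subspace_add[OF Y])
  next
    fix c x
    have "P (W (c *\<^sub>R x)) = c *\<^sub>R P (W x)"
      using P_lin W(2) unfolding linear_map_on_def linear_cmul[OF W(1)] by blast
    then show "Q (c *\<^sub>R x) = c *\<^sub>R Q x"
      using QY JQ by (intro Q_eqI) (auto simp: canonical_embedding_scale subspace_scale[OF Y])
  qed
  have dual_nonneg: "0 \<le> dual_norm Y norm f" if "f \<in> dual Y norm" for f
    using dual_norm_nonneg[OF that, of 0] subspace_0[OF Y] by auto
  have n_nonneg: "0 \<le> ?n z" if "z \<in> ?Z" for z
    unfolding bidual_norm_def
    by (rule dual_norm_nonneg[OF that[unfolded bidual_def] dual_nonneg zero_in_dual])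
       (simp_all add: dual_norm_zero[OF Y])
  have unit_ball: "norm (Q x) \<le> l\<^sub>1 * l\<^sub>2" if "norm x \<le> 1" for x
  proof -
    \<comment> \<open>Dividing by \<open>l\<^sub>2\<close> puts \<open>W ?u\<close> into the unit
      ball, where the operator norm of \<open>P\<close> gives a bound.\<close>
    let ?u = "x /\<^sub>R l\<^sub>2"
    have "l\<^sub>2 * norm ?u = norm x" using \<open>l\<^sub>2 > 0\<close> by simp
    then have "?n (W ?u) \<le> 1" using W(3)[of ?u] that by linarith
    have "norm (Q ?u) \<le> ?n (P (W ?u))"
      using norm_le_bidual_norm_canonical_embedding[OF Y QY] JQ by metis
    also have "\<dots> \<le> operator_norm ?Z ?n ?n P"
      using P(1) n_nonneg W(2) \<open>?n (W ?u) \<le> 1\<close> by (intro operator_norm_upper)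
    finally have "norm (Q ?u) \<le> l\<^sub>1" using P(2) by simp
    then show ?thesis using \<open>l\<^sub>2 > 0\<close> by (simp add: linear_cmul[OF \<open>linear Q\<close>] field_simps)
  qed
  have "norm (Q x) \<le> (l\<^sub>1 * l\<^sub>2) * norm x" for x
  proof (cases "x = 0")
    case True
    then show ?thesis by (simp add: linear_0[OF \<open>linear Q\<close>])
  next
    case False
    then show ?thesis
      using unit_ball[of "x /\<^sub>R norm x"] by (simp add: linear_cmul[OF \<open>linear Q\<close>] field_simps)
  qed
  then have "bounded_operator UNIV norm norm Q"
    unfolding bounded_operator_def linear_map_on_def
    using linear_add[OF \<open>linear Q\<close>] linear_cmul[OF \<open>linear Q\<close>] by blast
  moreover have "operator_norm UNIV norm norm Q \<le> l\<^sub>1 * l\<^sub>2"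
    by (rule operator_norm_least[of 0]) (use unit_ball in auto)
  moreover have "range Q = Y" using QY Q_id by (metis image_subsetI rangeI subsetI subset_antisym)
  ultimately show ?thesis unfolding complemented_def using Q_id by blast
qed

end
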